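(* Let $\alpha', \beta'$ be odd integers and $\gamma$ an integer, and let $q(n) = \frac{\alpha'}{2} n^2 + \frac{\beta'}{2} n + \gamma$ for $n \geq 0$ (an integer for every integer $n$). Then $D_q(n) = 2^{\lceil \log_2 n \rceil}$ for all integers $n \geq 1$ if and only if $\alpha' = \beta'$.
   Context: For an integer sequence $s = (s(i))_{i \geq 0}$ and an integer $n \geq 1$, the discriminator $D_s(n)$ is the least positive integer $m$ such that $s(0), \ldots, s(n-1)$ are pairwise incongruent modulo $m$. If two of $s(0), \ldots, s(n-1)$ are equal, no such $m$ exists, and then $D_s(n) \neq 2^{\lceil \log_2 n \rceil}$ is understood to hold. *)

theory Defs
  imports Complex_Main "HOL-Number_Theory.Cong"
begin

definition discriminates :: "(nat \<Rightarrow> int) \<Rightarrow> nat \<Rightarrow> nat \<Rightarrow> bool" where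
  "discriminates s n m \<longleftrightarrow>
     m > 0 \<and> (\<forall>i<n. \<forall>j<n. i \<noteq> j \<longrightarrow> \<not> [s i = s j] (mod int m))"

text \<open>The value \<open>None\<close> occurs exactly when two of \<open>s 0, \<dots>, s (n - 1)\<close> are equal, so that an
  equation \<open>discriminator s n = Some m\<close> is false in that case.\<close>

definition discriminator :: "(nat \<Rightarrow> int) \<Rightarrow> nat \<Rightarrow> nat option" where
  "discriminator s n =
     (if \<exists>m. discriminates s n m then Some (LEAST m. discriminates s n m) else None)"

lemma half_quadratic_in_Ints:
  fixes \<alpha>' \<beta>' \<gamma> n :: int
  assumes "odd \<alpha>'" and "odd \<beta>'"
  shows "of_int \<alpha>' / 2 * of_int n ^ 2 + of_int \<beta>' / 2 * of_int n + of_int \<gamma> \<in> (\<int> :: real set)"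
proof -
  have "even (\<alpha>' * n ^ 2 + \<beta>' * n)"
    using assms by simp
  then obtain k where "\<alpha>' * n ^ 2 + \<beta>' * n = 2 * k" ..
  then have "of_int \<alpha>' * of_int n ^ 2 + of_int \<beta>' * of_int n = 2 * (of_int k :: real)"
    by (metis of_int_add of_int_mult of_int_numeral of_int_power)
  then have "of_int \<alpha>' / 2 * of_int n ^ 2 + of_int \<beta>' / 2 * of_int n + of_int \<gamma>
      = (of_int (k + \<gamma>) :: real)"
    by (simp add: field_simps)
  then show ?thesis
    by (metis Ints_of_int)
qed

end

theory Submission
  imports Defs
begin

text \<open>
  Everything rests on the factorisation
  \<open>2 (q i - q j) = (i - j) (\<alpha>' (i + j) + \<beta>')\<close>, whose two factors have opposite parity, so that a
  power of two dividing the product divides one of them.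

  If \<open>\<alpha>' = \<beta>'\<close>, the second factor is an odd multiple of \<open>i + j + 1\<close>, so no collision modulo
  \<open>2 ^ k\<close> occurs among the first \<open>2 ^ k\<close> terms. A smaller modulus \<open>m = w (2 t + 1)\<close>, with \<open>w\<close> a power
  of two, is excluded by the index \<open>j = w + t\<close> and its partner \<open>i\<close> for which \<open>j - i\<close> and \<open>i + j + 1\<close>
  are \<open>2 w\<close> and \<open>2 t + 1\<close> in some order.

  Conversely, for every \<open>k\<close> the odd residue \<open>c\<close> of \<open>- \<beta>' / \<alpha>'\<close> modulo \<open>2 ^ (k + 1)\<close> is a sum \<open>i + j\<close>
  of distinct indices below \<open>2 ^ k\<close>, and hence yields a collision modulo \<open>2 ^ k\<close>, unless \<open>c = - 1\<close>,
  that is \<open>\<alpha>' \<equiv> \<beta>'\<close>.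
\<close>

lemma discriminator_eq_Some_iff:
  "discriminator s n = Some m \<longleftrightarrow> discriminates s n m \<and> (\<forall>l<m. \<not> discriminates s n l)"
  unfolding discriminator_def
  by (auto intro: LeastI dest: not_less_Least) (metis LeastI not_less_Least linorder_neqE_nat)

lemma le_two_power_ceiling_log:
  assumes "n \<ge> 1"
  shows "n \<le> 2 ^ nat \<lceil>log 2 (real n)\<rceil>"
proof -
  have "log 2 (real n) \<le> real (nat \<lceil>log 2 (real n)\<rceil>)"
    by (rule real_nat_ceiling_ge)
  then have "real n \<le> 2 powr real (nat \<lceil>log 2 (real n)\<rceil>)"
    using assms by (subst (asm) log_le_iff) simp_all
  then have "real n \<le> real (2 ^ nat \<lceil>log 2 (real n)\<rceil>)"
    by (simp add: powr_realpow)
  then show ?thesis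
    by (simp only: of_nat_le_iff)
qed

lemma two_power_ceiling_log_less:
  assumes "n \<ge> 1"
  shows "2 ^ nat \<lceil>log 2 (real n)\<rceil> < 2 * n"
proof -
  have "0 \<le> log 2 (real n)"
    using assms by simp
  then have "real (nat \<lceil>log 2 (real n)\<rceil>) < log 2 (real n) + 1"
    by linarith
  also have "\<dots> = log 2 (2 * real n)"
    using assms by (simp add: log_mult)
  finally have "2 powr real (nat \<lceil>log 2 (real n)\<rceil>) < 2 * real n"
    using assms by (simp add: less_log_iff)
  then have "real (2 ^ nat \<lceil>log 2 (real n)\<rceil>) < real (2 * n)"
    by (simp add: powr_realpow)
  then show ?thesis
    by (simp only: of_nat_less_iff)
qed

lemma exists_two_power_times_odd:
  fixes m :: nat
  assumes "m > 0"
  shows "\<exists>a t. m = 2 ^ a * (2 * t + 1)"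
  using assms
proof (induction m rule: less_induct)
  case (less m)
  show ?case
  proof (cases "even m")
    case True
    then obtain l where l: "m = 2 * l" ..
    with less.prems have "l < m" "l > 0"
      by simp_all
    then obtain a t where "l = 2 ^ a * (2 * t + 1)"
      using less.IH by blast
    with l have "m = 2 ^ Suc a * (2 * t + 1)"
      by simp
    then show ?thesis
      by blast
  next
    case False
    then obtain t where "m = 2 ^ 0 * (2 * t + 1)"
      by (auto elim: oddE)
    then show ?thesis
      by blast
  qed
qed

lemma two_power_dvd_multD_odd:
  fixes x y :: int
  assumes "2 ^ k dvd x * y" and "odd (x + y)"
  shows "2 ^ k dvd x \<or> 2 ^ k dvd y"
proof (cases "even x")
  case True
  then have "coprime (2 ^ k) y"
    using assms by simp
  then show ?thesis
    using assms(1) by (simp add: coprime_dvd_mult_left_iff)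
next
  case False
  then have "coprime (2 ^ k) x"
    by simp
  then show ?thesis
    using assms(1) by (simp add: coprime_dvd_mult_right_iff)
qed

text \<open>Congruences between terms depend only on differences, so \<open>\<gamma>\<close> drops
  out; doubling clears the denominators and keeps the factorisation in the integers.\<close>

locale half_quadratic =
  fixes \<alpha> \<beta> :: int and q :: "nat \<Rightarrow> int"
  assumes odd_\<alpha>: "odd \<alpha>"
    and double_diff: "2 * (q i - q j) = (int i - int j) * (\<alpha> * (int i + int j) + \<beta>)"
begin

lemma cong_iff:
  "[q i = q j] (mod int m) \<longleftrightarrow> 2 * int m dvd (int i - int j) * (\<alpha> * (int i + int j) + \<beta>)"
  unfolding double_diff[symmetric] cong_iff_dvd_diff dvd_mult_cancel_left by simp

lemma discriminates_two_power:
  assumes "\<alpha> = \<beta>" and "n \<le> 2 ^ k"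
  shows "discriminates q n (2 ^ k)"
  unfolding discriminates_def
proof (intro conjI allI impI notI)
  fix i j
  assume ij: "i < n" "j < n" "i \<noteq> j" and "[q i = q j] (mod int (2 ^ k))"
  from this(4) have "2 ^ Suc k dvd (int i - int j) * (\<alpha> * (int i + int j) + \<beta>)"
    unfolding cong_iff by (simp only: of_nat_power of_nat_numeral power_Suc)
  also have "\<dots> = \<alpha> * ((int i - int j) * (int i + int j + 1))"
    using assms(1) by (simp add: algebra_simps)
  finally have "2 ^ Suc k dvd (int i - int j) * (int i + int j + 1)"
    using odd_\<alpha> by (subst (asm) coprime_dvd_mult_right_iff) auto
  then have "2 ^ Suc k dvd int i - int j \<or> 2 ^ Suc k dvd int i + int j + 1"
    by (rule two_power_dvd_multD_odd) simp
  \<comment> \<open>Both factors are nonzero, yet for distinct indices below \<open>n\<close> each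
    is smaller than \<open>2 * n\<close>, hence than \<open>2 ^ Suc k\<close>.\<close>
  then have "2 ^ Suc k \<le> \<bar>int i - int j\<bar> \<or> 2 ^ Suc k \<le> int i + int j + 1"
    using ij(3) dvd_imp_le_int[of "int i - int j" "2 ^ Suc k"] zdvd_imp_le by force
  moreover have "int n \<le> 2 ^ k"
    using assms(2) by (metis of_nat_le_iff of_nat_numeral of_nat_power)
  ultimately show False
    using ij unfolding power_Suc by linarith
qed simp

lemma not_discriminates_less_two_power:
  assumes "\<alpha> = \<beta>" and "2 ^ k < 2 * n" and "m < 2 ^ k"
  shows "\<not> discriminates q n m"
proof
  assume d: "discriminates q n m"
  then have "m > 0"
    by (simp add: discriminates_def)
  then obtain a t where m: "m = 2 ^ a * (2 * t + 1)"
    using exists_two_power_times_odd by blast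
  define w :: nat where "w = 2 ^ a"
  have w: "w \<ge> 1" "m = w * (2 * t + 1)"
    by (simp_all add: w_def m)
  have "2 * (w + t) \<le> 2 ^ k"
  proof (cases "t = 0")
    case True
    then have "a < k"
      using m assms(3) by simp
    then have "(2::nat) ^ Suc a \<le> 2 ^ k"
      by (intro power_increasing) auto
    with True show ?thesis
      by (simp add: w_def)
  next
    case False
    then obtain t' w' where "t = Suc t'" "w = Suc w'"
      using w(1) by (metis not0_implies_Suc not_one_le_zero)
    \<comment> \<open>The gap \<open>m + 1 - 2 * (w + t)\<close> equals
      \<open>(w - 1) * (2 * t - 1)\<close>, which is nonnegative.\<close>
    then have "2 * (w + t) \<le> m + 1"
      by (simp add: w(2) algebra_simps)
    then show ?thesis
      using assms(3) by simp
  qed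
  then have j: "w + t < n"
    using assms(2) by simp
  \<comment> \<open>With \<open>j = w + t\<close>, the first case gives
    \<open>j - i = 2 * t + 1\<close> and \<open>i + j + 1 = 2 * w\<close>; the second swaps these
    values. The case split keeps the subtraction exact, and the product is \<open>2 * m\<close>
    either way.\<close>
  define i where "i = (if t < w then w - t - 1 else t - w)"
  have i: "i < w + t"
    using w(1) by (auto simp: i_def)
  have "(int i - int (w + t)) * (\<alpha> * (int i + int (w + t)) + \<beta>) = 2 * int m * (- \<alpha>)"
    using assms(1) by (auto simp: i_def w(2) of_nat_diff algebra_simps)
  then have "[q i = q (w + t)] (mod int m)"
    by (simp only: cong_iff dvd_triv_left)
  then show False
    using d i j by (auto simp: discriminates_def)
qed

lemma coefficients_eq_if_discriminates_two_power:
  assumes "odd \<beta>" and d: "\<And>k. discriminates q (2 ^ k) (2 ^ k)"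
  shows "\<alpha> = \<beta>"
proof -
  \<comment> \<open>An exponent this large makes \<open>0\<close> the only possible value of
    \<open>\<alpha> - \<beta>\<close> divisible by \<open>2 ^ Suc k\<close>.\<close>
  define k where "k = nat \<bar>\<alpha> - \<beta>\<bar>"
  have small: "\<bar>\<alpha> - \<beta>\<bar> < 2 ^ Suc k"
  proof -
    have "int k < int (2 ^ k)"
      by (simp only: of_nat_less_iff less_exp)
    then show ?thesis
      by (simp add: k_def)
  qed
  have "coprime \<alpha> (2 ^ Suc k)"
    using odd_\<alpha> by (simp add: coprime_commute)
  then obtain x where x: "[\<alpha> * x = 1] (mod 2 ^ Suc k)"
    using cong_solve_coprime_int by blast
  define c where "c = (x * (- \<beta>)) mod 2 ^ Suc k"
  have "[c = x * (- \<beta>)] (mod 2 ^ Suc k)"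
    by (simp only: c_def cong_def mod_mod_trivial)
  then have "[\<alpha> * c = \<alpha> * (x * (- \<beta>))] (mod 2 ^ Suc k)"
    by (rule cong_scalar_left)
  also have "[\<alpha> * (x * (- \<beta>)) = 1 * (- \<beta>)] (mod 2 ^ Suc k)"
    using cong_scalar_right[OF x, of "- \<beta>"] by (simp only: mult.assoc)
  finally have c: "2 ^ Suc k dvd \<alpha> * c + \<beta>"
    by (simp add: cong_iff_dvd_diff)
  have c_bounds: "0 \<le> c" "c < 2 ^ Suc k"
    by (simp_all add: c_def)
  have "even (\<alpha> * c + \<beta>)"
    using c by (rule dvd_trans[rotated]) simp
  then have "odd c"
    using assms(1) by auto
  then obtain t where t: "c = 2 * int t + 1"
    using c_bounds that[of "nat (c div 2)"] by simp
  \<comment> \<open>The odd number \<open>c\<close> is the sum of the neighbours \<open>t\<close>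
    and \<open>Suc t\<close>, which collide modulo \<open>2 ^ k\<close>. Since
    \<open>c < 2 ^ Suc k\<close>, only this extreme \<open>t\<close> pushes \<open>Suc t\<close> out
    of range.\<close>
  have "t = 2 ^ k - 1"
  proof (rule ccontr)
    assume "t \<noteq> 2 ^ k - 1"
    moreover have "int t < 2 ^ k"
      using c_bounds t unfolding power_Suc by linarith
    then have "t < 2 ^ k"
      by simp
    ultimately have "Suc t < 2 ^ k"
      by linarith
    moreover have "2 * int (2 ^ k) dvd (int t - int (Suc t)) * (\<alpha> * (int t + int (Suc t)) + \<beta>)"
      using c by (intro dvd_mult) (simp add: t algebra_simps)
    then have "[q t = q (Suc t)] (mod int (2 ^ k))"
      by (simp only: cong_iff)
    ultimately show False
      using d[of k] by (auto simp: discriminates_def)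
  qed
  then have "c = 2 ^ Suc k - 1"
    by (simp add: t of_nat_diff)
  then have "\<alpha> * c + \<beta> = \<alpha> * 2 ^ Suc k - (\<alpha> - \<beta>)"
    by (simp add: right_diff_distrib)
  with c have "2 ^ Suc k dvd \<alpha> - \<beta>"
    by (metis dvd_triv_right dvd_diff_right_iff)
  with small show ?thesis
    using dvd_imp_le_int[of "\<alpha> - \<beta>" "2 ^ Suc k"] by force
qed

end

theorem theorem11:
  fixes \<alpha>' \<beta>' \<gamma> :: int and q :: "nat \<Rightarrow> int"
  assumes "odd \<alpha>'" and "odd \<beta>'"
    and "\<And>n. real_of_int (q n)
           = real_of_int \<alpha>' / 2 * real n ^ 2 + real_of_int \<beta>' / 2 * real n + real_of_int \<gamma>"
  shows "(\<forall>n\<ge>1. discriminator q n = Some (2 ^ nat \<lceil>log 2 (real n)\<rceil>)) \<longleftrightarrow> \<alpha>' = \<beta>'"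
proof -
  interpret half_quadratic \<alpha>' \<beta>' q
  proof
    fix i j
    have "real_of_int (2 * (q i - q j))
        = real_of_int ((int i - int j) * (\<alpha>' * (int i + int j) + \<beta>'))"
      by (simp add: assms(3) field_simps power2_eq_square)
    then show "2 * (q i - q j) = (int i - int j) * (\<alpha>' * (int i + int j) + \<beta>')"
      by (simp only: of_int_eq_iff)
  qed (rule assms(1))
  show ?thesis
  proof
    assume *: "\<forall>n\<ge>1. discriminator q n = Some (2 ^ nat \<lceil>log 2 (real n)\<rceil>)"
    \<comment> \<open>At \<open>n = 2 ^ k\<close> the logarithm is exactly \<open>k\<close>, so the
      ceiling changes nothing.\<close>
    have "discriminates q (2 ^ k) (2 ^ k)" for k
      using *[rule_format, of "2 ^ k"]
      by (simp add: discriminator_eq_Some_iff log_nat_power)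
    then show "\<alpha>' = \<beta>'"
      by (rule coefficients_eq_if_discriminates_two_power[OF assms(2)])
  next
    assume eq: "\<alpha>' = \<beta>'"
    show "\<forall>n\<ge>1. discriminator q n = Some (2 ^ nat \<lceil>log 2 (real n)\<rceil>)"
      unfolding discriminator_eq_Some_iff
      using discriminates_two_power[OF eq le_two_power_ceiling_log]
        not_discriminates_less_two_power[OF eq two_power_ceiling_log_less]
      by blast
  qed
qed

end
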